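(* The Backward Farey map $J$ is topologically conjugated to the doubling map $B$ via the Minkowski Question Mark function $?$. That is, for every $x\in[0,1]$, $$(B\circ ?)(x)=(?\circ J)(x).$$
   Context: The Backward Farey map $J:[0,1]\to[0,1]$ is $J(x)=\frac{x}{1-x}$ for $x\in[0,1/2)$ and $J(x)=\frac{2x-1}{x}$ for $x\in[1/2,1]$. The doubling map $B:[0,1]\to[0,1]$ is $B(x)=2x$ for $x\in[0,1/2)$ and $B(x)=2x-1$ for $x\in[1/2,1]$. The Minkowski Question Mark function $?:[0,1]\to[0,1]$ is the continuous strictly increasing function (a homeomorphism of $[0,1]$) defined inductively on rationals by $?(0)=0$, $?(1)=1$ and $?\left(\frac{p+p'}{q+q'}\right)=\frac{?(p/q)+?(p'/q')}{2}$ whenever $p/q,p'/q'\in[0,1]$ are rationals in lowest terms with $p'q-pq'=1$, and extended to irrationals by continuity. Two maps $A_1:X\to X$ and $A_2:Y\to Y$ are topologically conjugated via a homeomorphism $g:X\to Y$ if $g\circ A_1=A_2\circ g$. *)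

theory Defs
  imports "HOL-Analysis.Analysis"
begin

text \<open>All maps of \<open>[0,1]\<close> are total functions on the reals; only their values on \<open>{0..1}\<close>
  are meaningful.\<close>

definition backward_farey :: "real \<Rightarrow> real" where
  "backward_farey x = (if x < 1/2 then x / (1 - x) else (2 * x - 1) / x)"

definition doubling_map :: "real \<Rightarrow> real" where
  "doubling_map x = (if x < 1/2 then 2 * x else 2 * x - 1)"

text \<open>The graph of \<open>?\<close> on the rationals of \<open>[0,1]\<close>. The fractions \<open>p/q\<close> and \<open>p'/q'\<close> are in
  lowest terms with positive denominators, so that the mediant depends only on their values.\<close>

inductive question_mark_graph :: "real \<Rightarrow> real \<Rightarrow> bool" where
  zero: "question_mark_graph 0 0"
| one: "question_mark_graph 1 1"
| mediant: "\<lbrakk>q > 0; q' > 0; coprime p q; coprime p' q';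
     real_of_int p / real_of_int q \<in> {0..1}; real_of_int p' / real_of_int q' \<in> {0..1};
     p' * q - p * q' = 1;
     question_mark_graph (of_int p / of_int q) a;
     question_mark_graph (of_int p' / of_int q') b\<rbrakk>
   \<Longrightarrow> question_mark_graph (of_int (p + p') / of_int (q + q')) ((a + b) / 2)"
  for p q p' q' :: int

definition question_mark_rat :: "real \<Rightarrow> real" where
  "question_mark_rat x = (THE y. question_mark_graph x y)"

text \<open>Extension by continuity: at an irrational point, the limit along the rationals of \<open>[0,1]\<close>.\<close>

definition question_mark :: "real \<Rightarrow> real" where
  "question_mark x = (if x \<in> \<rat> then question_mark_rat x
     else Lim (at x within \<rat> \<inter> {0..1}) question_mark_rat)"

definition topologically_conjugated_via ::
  "'a::topological_space set \<Rightarrow> ('a \<Rightarrow> 'a) \<Rightarrow> 'b::topological_space set \<Rightarrow> ('b \<Rightarrow> 'b) \<Rightarrow> ('a \<Rightarrow> 'b) \<Rightarrow> bool"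
  where "topologically_conjugated_via X A\<^sub>1 Y A\<^sub>2 g \<longleftrightarrow>
    A\<^sub>1 \<in> X \<rightarrow> X \<and> A\<^sub>2 \<in> Y \<rightarrow> Y \<and> (\<exists>h. homeomorphism X Y g h) \<and>
    (\<forall>x\<in>X. (g \<circ> A\<^sub>1) x = (A\<^sub>2 \<circ> g) x)"

end

theory Submission
  imports Defs
begin

text \<open>The conjugacy equation \<open>B \<circ> F = F \<circ> J\<close> with \<open>F 0 = 0\<close>, \<open>F 1 = 1\<close> says that \<open>F\<close> is a fixed
  point of the operator sending \<open>f\<close> to \<open>f \<circ> J / 2\<close> on the left half of the interval and to
  \<open>(1 + f \<circ> J) / 2\<close> on the right half. This operator halves sup-distances and preserves continuous
  monotone functions, so iterating it from the identity gives a continuous monotone solution \<open>F\<close>.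
  The branches of \<open>J\<close> act on fractions by integer matrices of determinant one, so \<open>F\<close> satisfies
  the mediant rule on unimodular pairs, by induction on the denominators; hence it equals \<open>?\<close>
  on the rationals, and by continuity everywhere. Strict monotonicity comes from the same
  induction, since every interval contains a unimodular pair.\<close>

section \<open>Iterates of the operator and their uniform limit\<close>

lemma backward_farey_mem:
  assumes "x \<in> {0..1}"
  shows "backward_farey x \<in> {0..1}"
  using assms by (auto simp: backward_farey_def field_simps)

lemma doubling_map_mem:
  assumes "x \<in> {0..1}"
  shows "doubling_map x \<in> {0..1}"
  using assms by (auto simp: doubling_map_def)

fun farey_iterate :: "nat \<Rightarrow> real \<Rightarrow> real" where
  "farey_iterate 0 x = x"
| "farey_iterate (Suc n) x =
     (if x < 1/2 then farey_iterate n (backward_farey x) / 2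
      else (1 + farey_iterate n (backward_farey x)) / 2)"

definition farey_limit :: "real \<Rightarrow> real" where
  "farey_limit x = lim (\<lambda>n. farey_iterate n x)"

lemma farey_iterate_0 [simp]: "farey_iterate n 0 = 0"
  by (induction n) (auto simp: backward_farey_def)

lemma farey_iterate_1 [simp]: "farey_iterate n 1 = 1"
  by (induction n) (auto simp: backward_farey_def)

lemma farey_iterate_mem:
  "x \<in> {0..1} \<Longrightarrow> farey_iterate n x \<in> {0..1}"
proof (induction n arbitrary: x)
  case (Suc n)
  show ?case
    using Suc.IH[OF backward_farey_mem[OF Suc.prems]] by auto
qed auto

lemma farey_iterate_mono:
  "0 \<le> x \<Longrightarrow> x \<le> y \<Longrightarrow> y \<le> 1 \<Longrightarrow> farey_iterate n x \<le> farey_iterate n y"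
proof (induction n arbitrary: x y)
  case (Suc n)
  have x: "x \<in> {0..1}" and y: "y \<in> {0..1}" using Suc.prems by auto
  note bx = backward_farey_mem[OF x] and b_y = backward_farey_mem[OF y]
  show ?case
  proof (cases "x < 1/2 \<longleftrightarrow> y < 1/2")
    case True
    have "backward_farey x \<le> backward_farey y"
      using Suc.prems True by (auto simp: backward_farey_def field_simps)
    then have "farey_iterate n (backward_farey x) \<le> farey_iterate n (backward_farey y)"
      using bx b_y by (intro Suc.IH) auto
    then show ?thesis using True by auto
  next
    \<comment> \<open>The halves differ, so \<open>x\<close> lies left of 1/2 and \<open>y\<close>
      does not: the first value is at most 1/2 and the second at least 1/2.\<close>
    case False
    then show ?thesis
      using Suc.prems farey_iterate_mem[OF bx, of n] farey_iterate_mem[OF b_y, of n] by auto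
  qed
qed auto

lemma continuous_on_farey_iterate: "continuous_on {0..1} (farey_iterate n)"
proof (induction n)
  case 0
  then show ?case by (simp add: continuous_on_id)
next
  case (Suc n)
  \<comment> \<open>\<open>backward_farey\<close> jumps from 1 to 0 at 1/2, but the fixed values at
    1 and 0 make both branches equal 1/2 there, so they glue continuously.\<close>
  have half: "farey_iterate n (x / (1 - x)) / 2 = (1 + farey_iterate n ((2 * x - 1) / x)) / 2"
    if "x = 1/2" for x
    unfolding that by simp
  have left: "continuous_on {0..1/2} (\<lambda>x. farey_iterate n (x / (1 - x)) / 2)"
    by (intro continuous_intros continuous_on_compose2[OF Suc.IH]) (auto simp: field_simps)
  have right: "continuous_on {1/2..1} (\<lambda>x. (1 + farey_iterate n ((2 * x - 1) / x)) / 2)"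
    by (intro continuous_intros continuous_on_compose2[OF Suc.IH]) (auto simp: field_simps)
  have "continuous_on ({0..1/2} \<union> {1/2..1})
      (\<lambda>x. if x \<le> 1/2 then farey_iterate n (x / (1 - x)) / 2
           else (1 + farey_iterate n ((2 * x - 1) / x)) / 2)"
    using half by (intro continuous_on_If[OF _ _ left right]) force+
  also have "{0..1/2} \<union> {1/2..1} = {0..1::real}" by auto
  finally show ?case
    by (rule continuous_on_eq) (use half in \<open>force simp: backward_farey_def\<close>)
qed

text \<open>Both iterates take the same branch at \<open>x\<close>, so the constant 1/2 cancels and
  each level halves the difference; at the start both values lie in the unit interval.\<close>

lemma farey_iterate_Suc_diff:
  "x \<in> {0..1} \<Longrightarrow> \<bar>farey_iterate (Suc n) x - farey_iterate n x\<bar> \<le> (1/2) ^ n"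
proof (induction n arbitrary: x)
  case 0
  then show ?case
    using farey_iterate_mem[of x "Suc 0"] by (auto simp del: farey_iterate.simps(2))
next
  case (Suc n)
  have "\<bar>farey_iterate (Suc (Suc n)) x - farey_iterate (Suc n) x\<bar>
      = \<bar>farey_iterate (Suc n) (backward_farey x) - farey_iterate n (backward_farey x)\<bar> / 2"
    unfolding farey_iterate.simps(2)[of _ x] by (simp add: field_simps abs_if del: farey_iterate.simps)
  then show ?case
    using Suc.IH[OF backward_farey_mem[OF Suc.prems]] by (simp del: farey_iterate.simps)
qed

text \<open>The iterates are partial sums of a telescoping series added to the identity, and the
  M-test applies with a geometric majorant.\<close>

lemma uniform_limit_farey_limit:
  "uniform_limit {0..1} farey_iterate farey_limit sequentially"
proof -
  let ?d = "\<lambda>n x. farey_iterate (Suc n) x - farey_iterate n x"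
  have "uniform_limit {0..1} (\<lambda>n x. \<Sum>i<n. ?d i x) (\<lambda>x. suminf (\<lambda>i. ?d i x)) sequentially"
    using farey_iterate_Suc_diff
    by (intro Weierstrass_m_test[where M = "\<lambda>n. (1/2) ^ n"])
       (auto simp del: farey_iterate.simps intro!: summable_geometric)
  then have "uniform_limit {0..1} (\<lambda>n x. x + (\<Sum>i<n. ?d i x))
      (\<lambda>x. x + suminf (\<lambda>i. ?d i x)) sequentially"
    by (intro uniform_limit_intros)
  moreover have "x + (\<Sum>i<n. ?d i x) = farey_iterate n x" for n x
    by (subst sum_lessThan_telescope) simp
  ultimately have ul: "uniform_limit {0..1} farey_iterate
      (\<lambda>x. x + suminf (\<lambda>i. ?d i x)) sequentially" by simp
  have "farey_limit x = x + suminf (\<lambda>i. ?d i x)" if "x \<in> {0..1}" for x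
    unfolding farey_limit_def using tendsto_uniform_limitI[OF ul that] by (rule limI)
  then show ?thesis
    using ul by (subst uniform_limit_cong') auto
qed

lemma farey_iterate_tendsto:
  "x \<in> {0..1} \<Longrightarrow> (\<lambda>n. farey_iterate n x) \<longlonglongrightarrow> farey_limit x"
  using uniform_limit_farey_limit by (rule tendsto_uniform_limitI)

lemma continuous_on_farey_limit: "continuous_on {0..1} farey_limit"
  by (rule uniform_limit_theorem[OF _ uniform_limit_farey_limit])
     (auto simp: continuous_on_farey_iterate)

lemma farey_limit_0 [simp]: "farey_limit 0 = 0"
  and farey_limit_1 [simp]: "farey_limit 1 = 1"
  by (simp_all add: farey_limit_def)

lemma farey_limit_mono:
  assumes "0 \<le> x" "x \<le> y" "y \<le> 1"
  shows "farey_limit x \<le> farey_limit y"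
  using assms
  by (intro LIMSEQ_le[OF farey_iterate_tendsto farey_iterate_tendsto])
     (auto intro: farey_iterate_mono)

lemma farey_limit_mem:
  assumes "x \<in> {0..1}"
  shows "farey_limit x \<in> {0..1}"
  using farey_limit_mono[of 0 x] farey_limit_mono[of x 1] assms by simp

lemma farey_limit_functional_equation:
  assumes "x \<in> {0..1}"
  shows "farey_limit x = (if x < 1/2 then farey_limit (backward_farey x) / 2
           else (1 + farey_limit (backward_farey x)) / 2)"
proof -
  have "(\<lambda>n. farey_iterate (Suc n) x) \<longlonglongrightarrow>
      (if x < 1/2 then farey_limit (backward_farey x) / 2
       else (1 + farey_limit (backward_farey x)) / 2)"
    using farey_iterate_tendsto[OF backward_farey_mem[OF assms]]
    by (auto intro!: tendsto_intros)
  moreover have "(\<lambda>n. farey_iterate (Suc n) x) \<longlonglongrightarrow> farey_limit x"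
    using farey_iterate_tendsto[OF assms] by (rule LIMSEQ_Suc)
  ultimately show ?thesis by (rule LIMSEQ_unique[symmetric])
qed

section \<open>The limit function on fractions\<close>

lemma farey_limit_half [simp]: "farey_limit (1/2) = 1/2"
  using farey_limit_functional_equation[of "1/2"] by (simp add: backward_farey_def)

lemma farey_limit_left_half:
  fixes p q :: int
  assumes "0 \<le> p" "2 * p \<le> q" "0 < q"
  shows "farey_limit (of_int p / of_int q) = farey_limit (of_int p / of_int (q - p)) / 2"
proof (cases "2 * p = q")
  \<comment> \<open>At 1/2 \<open>backward_farey\<close> uses its other branch, but the left formula
    still holds because \<open>farey_limit\<close> is 1 at 1.\<close>
  case True
  then have "real_of_int p / of_int q = 1/2" "real_of_int p / of_int (q - p) = 1"
    using assms by (auto simp: field_simps)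
  then show ?thesis by simp
next
  case False
  then have lt: "real_of_int p / of_int q < 1/2" using assms by (simp add: field_simps)
  have "backward_farey (of_int p / of_int q) = of_int p / of_int (q - p)"
    using lt assms False unfolding backward_farey_def by (simp add: field_simps)
  then show ?thesis
    using farey_limit_functional_equation[of "of_int p / of_int q"] lt assms by simp
qed

lemma farey_limit_right_half:
  fixes p q :: int
  assumes "p \<le> q" "q \<le> 2 * p" "0 < q"
  shows "farey_limit (of_int p / of_int q)
       = (1 + farey_limit (of_int (2 * p - q) / of_int p)) / 2"
proof -
  have ge: "\<not> real_of_int p / of_int q < 1/2" using assms by (simp add: field_simps)
  have "backward_farey (of_int p / of_int q) = of_int (2 * p - q) / of_int p"
    using ge assms unfolding backward_farey_def by (simp add: field_simps)
  then show ?thesis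
    using farey_limit_functional_equation[of "of_int p / of_int q"] ge assms by simp
qed

text \<open>A unimodular pair other than \<open>0/1, 1/1\<close> lies in one half of the unit interval, and
  \<^const>\<open>backward_farey\<close> maps it to a unimodular pair with smaller denominators.\<close>

lemma unimodular_same_half:
  fixes p q p' q' :: int
  assumes "0 \<le> p" "p \<le> q" "0 \<le> p'" "p' \<le> q'" "p' * q - p * q' = 1"
  obtains "p = 0" "q = 1" "p' = 1" "q' = 1" | "2 * p \<le> q" "2 * p' \<le> q'"
    | "q \<le> 2 * p" "q' \<le> 2 * p'"
proof -
  note zero_one = that(1)
  \<comment> \<open>If 1/2 lies strictly between the fractions, integrality bounds the determinant
    below by \<open>p + p'\<close>, which forces 0/1 and 1/1.\<close>
  have *: ?thesis if A: "2 * p < q" "q' < 2 * p'"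
  proof -
    have "p' * (2 * p + 1) \<le> p' * q" "p * q' \<le> p * (2 * p' - 1)"
      using A assms by (intro mult_left_mono; simp)+
    then have "p + p' \<le> 1" using assms(5) by (simp add: algebra_simps)
    then have "p = 0" "p' = 1" using A assms by auto
    moreover from this have "q = 1" "q' = 1" using A assms by auto
    ultimately show ?thesis using zero_one by blast
  qed
  \<comment> \<open>In the reverse order the determinant would be at most \<open>- (p + p')\<close>,
    hence not 1.\<close>
  have **: False if A: "q < 2 * p" "2 * p' < q'"
  proof -
    have "p' * q \<le> p' * (2 * p - 1)" "p * (2 * p' + 1) \<le> p * q'"
      using A assms by (intro mult_left_mono; simp)+
    then show False using assms by (simp add: algebra_simps)
  qed
  consider "2 * p \<le> q" "2 * p' \<le> q'" | "q \<le> 2 * p" "q' \<le> 2 * p'"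
    | "2 * p < q" "q' < 2 * p'" | "q < 2 * p" "2 * p' < q'" by linarith
  then show ?thesis using * ** that by cases auto
qed

text \<open>Each branch acts linearly on (numerator, denominator), so it commutes with mediants and
  keeps the determinant. The matching affine map on values respects averages and strict order, so
  both claims pass through one induction.\<close>

lemma farey_limit_unimodular:
  fixes p q p' q' :: int
  assumes "0 \<le> p" "p \<le> q" "0 < q" "0 \<le> p'" "p' \<le> q'" "0 < q'" "p' * q - p * q' = 1"
  shows "farey_limit (of_int (p + p') / of_int (q + q')) =
           (farey_limit (of_int p / of_int q) + farey_limit (of_int p' / of_int q')) / 2 \<and>
         farey_limit (of_int p / of_int q) < farey_limit (of_int p' / of_int q')"
  using assms
proof (induction "nat (q + q')" arbitrary: p q p' q' rule: less_induct)
  case less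
  \<comment> \<open>Makes the sum of denominators drop by \<open>p + p' > 0\<close> in the left
    half.\<close>
  have pos: "p > 0 \<or> p' > 0" 
  proof (rule ccontr)
    assume "\<not> (p > 0 \<or> p' > 0)"
    then have "p = 0" "p' = 0" using less.prems by auto
    then show False using less.prems by simp
  qed
  show ?case
  proof (rule unimodular_same_half[of p q p' q'])
    assume "p = 0" "q = 1" "p' = 1" "q' = 1"
    then show ?thesis by simp
  next
    assume h: "2 * p \<le> q" "2 * p' \<le> q'"
    have "farey_limit (of_int (p + p') / of_int ((q - p) + (q' - p'))) =
        (farey_limit (of_int p / of_int (q - p)) + farey_limit (of_int p' / of_int (q' - p'))) / 2 \<and>
        farey_limit (of_int p / of_int (q - p)) < farey_limit (of_int p' / of_int (q' - p'))"
      using less.prems h pos by (intro less.hyps) (auto simp: algebra_simps)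
    moreover have "(q - p) + (q' - p') = (q + q') - (p + p')" by simp
    ultimately show ?thesis
      using farey_limit_left_half[of p q] farey_limit_left_half[of p' q']
        farey_limit_left_half[of "p + p'" "q + q'"] h less.prems by (simp del: of_int_add of_int_diff)
  next
    assume h: "q \<le> 2 * p" "q' \<le> 2 * p'"
    \<comment> \<open>The fractions are not both 1, so the new denominator sum \<open>p + p'\<close>
      is strictly smaller.\<close>
    have "p \<noteq> q \<or> p' \<noteq> q'" using less.prems by auto
    then have "p + p' < q + q'" using less.prems by auto
    then have "farey_limit (of_int ((2 * p - q) + (2 * p' - q')) / of_int (p + p')) =
        (farey_limit (of_int (2 * p - q) / of_int p) + farey_limit (of_int (2 * p' - q') / of_int p')) / 2 \<and>
        farey_limit (of_int (2 * p - q) / of_int p) < farey_limit (of_int (2 * p' - q') / of_int p')"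
      using less.prems h by (intro less.hyps) (auto simp: algebra_simps)
    moreover have "(2 * p - q) + (2 * p' - q') = 2 * (p + p') - (q + q')" by simp
    ultimately show ?thesis
      using farey_limit_right_half[of p q] farey_limit_right_half[of p' q']
        farey_limit_right_half[of "p + p'" "q + q'"] h less.prems
      by (simp del: of_int_add of_int_diff of_int_mult)
  qed (use less.prems in auto)
qed

section \<open>Agreement with the Question Mark function on rationals\<close>

lemma question_mark_graph_farey_limit:
  "question_mark_graph x y \<Longrightarrow> y = farey_limit x"
proof (induction rule: question_mark_graph.induct)
  case (mediant p q p' q' a b)
  then have "0 \<le> p" "p \<le> q" "0 \<le> p'" "p' \<le> q'"
    by (auto simp: zero_le_divide_iff)
  then show ?case using farey_limit_unimodular[of p q p' q'] mediant by simp
qed auto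

text \<open>Supplies the Farey parents \<open>(p - c)/(q - d)\<close> and \<open>c/d\<close>, whose
  mediant is \<open>p/q\<close>; their smaller denominators drive the induction on
  \<open>q\<close>.\<close>

lemma unimodular_parents:
  fixes p q :: int
  assumes "coprime p q" "0 < p" "p < q"
  obtains c d where "0 < d" "d < q" "0 \<le> c" "c \<le> d" "0 \<le> p - c" "p - c \<le> q - d"
    "c * q - p * d = 1"
proof -
  obtain u v where uv: "u * p + v * q = 1"
    using assms(1) by (metis bezout_int coprime_imp_gcd_eq_1)
  \<comment> \<open>The target equation requires \<open>p * d\<close> to be -1 modulo
    \<open>q\<close>, and \<open>u\<close> inverts \<open>p\<close> modulo \<open>q\<close>.\<close>
  define d where "d = (- u) mod q"
  have d0: "0 \<le> d" "d < q" using assms by (auto simp: d_def)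
  have "d mod q = (- u) mod q" by (simp add: d_def)
  then have "q dvd d - (- u)" by (simp only: mod_eq_dvd_iff)
  then obtain k where k: "d + u = q * k" by (auto elim: dvdE)
  define c where "c = p * k + v"
  have cd: "c * q - p * d = 1"
    using uv k by (simp add: c_def algebra_simps) algebra
  have "d \<noteq> 0" using cd assms by (auto simp: zmult_eq_1_iff)
  then have d: "0 < d" using d0 by simp
  have "0 < c * q" using cd d assms by (smt (verit) mult_pos_pos)
  then have c: "0 < c" using assms by (simp add: zero_less_mult_iff)
  have "p * d \<le> (q - 1) * d" using assms d by (intro mult_right_mono) auto
  then have "c * q \<le> d * q" using cd d by (simp add: algebra_simps)
  then have c_d: "c \<le> d" using assms by simp
  have "p * d \<le> p * (q - 1)" using assms d0 by (intro mult_left_mono) auto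
  then have "c * q \<le> p * q" using cd assms by (simp add: algebra_simps)
  then have c_p: "c \<le> p" using assms by simp
  \<comment> \<open>Otherwise \<open>c * (q - d) - (p - c) * d\<close>, which equals 1, would be at
    most \<open>- d\<close>.\<close>
  have "p - c \<le> q - d"
  proof (rule ccontr)
    assume "\<not> p - c \<le> q - d"
    then have "(q - d) * c \<le> (q - d) * d" "(q - d + 1) * d \<le> (p - c) * d"
      using c_d d d0 by (auto intro!: mult_left_mono mult_right_mono)
    then show False using cd d by (simp add: algebra_simps)
  qed
  then show ?thesis using that[OF d d0(2) _ c_d _ _ cd] c c_p by simp
qed

lemma coprime_if_unimodular:
  fixes p q p' q' :: int
  assumes "p' * q - p * q' = 1"
  shows "coprime p q" "coprime p' q'"
proof -
  show "coprime p q"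
  proof (rule coprimeI)
    fix c assume "c dvd p" "c dvd q"
    then have "c dvd p' * q - p * q'" by (intro dvd_diff) auto
    then show "is_unit c" using assms by simp
  qed
  show "coprime p' q'"
  proof (rule coprimeI)
    fix c assume "c dvd p'" "c dvd q'"
    then have "c dvd p' * q - p * q'" by (intro dvd_diff) auto
    then show "is_unit c" using assms by simp
  qed
qed

lemma question_mark_graph_total:
  fixes p q :: int
  assumes "coprime p q" "0 \<le> p" "p \<le> q" "0 < q"
  shows "\<exists>y. question_mark_graph (of_int p / of_int q) y"
  using assms
proof (induction "nat q" arbitrary: p q rule: less_induct)
  case less
  consider "p = 0" | "p = q" | "0 < p" "p < q" using less.prems by linarith
  then show ?case
  proof cases
    case 3
    obtain c d where cd: "0 < d" "d < q" "0 \<le> c" "c \<le> d" "0 \<le> p - c" "p - c \<le> q - d"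
      "c * q - p * d = 1"
      using unimodular_parents[OF less.prems(1) 3] by blast
    \<comment> \<open>Subtracting one column from the other preserves the determinant, so the
      parents are unimodular and in lowest terms.\<close>
    have u: "c * (q - d) - (p - c) * d = 1" using cd(7) by (simp add: algebra_simps)
    obtain a b where "question_mark_graph (of_int (p - c) / of_int (q - d)) a"
      "question_mark_graph (of_int c / of_int d) b"
      using less.hyps[of "q - d" "p - c"] less.hyps[of d c] cd coprime_if_unimodular[OF u] by auto
    then have "question_mark_graph (of_int ((p - c) + c) / of_int ((q - d) + d)) ((a + b) / 2)"
      using cd coprime_if_unimodular[OF u] u
      by (intro question_mark_graph.mediant) auto
    then show ?thesis by auto
  qed (use less.prems in \<open>auto intro: question_mark_graph.intros\<close>)
qed

lemma question_mark_rat_eq_farey_limit: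
  assumes "x \<in> \<rat>" "x \<in> {0..1}"
  shows "question_mark_rat x = farey_limit x"
proof -
  obtain p q :: int where pq: "q > 0" "coprime p q" "x = of_int p / of_int q"
    using Rats_cases'[OF assms(1)] by metis
  then obtain y where "question_mark_graph x y"
    using question_mark_graph_total[of p q] assms by (auto simp: zero_le_divide_iff)
  \<comment> \<open>Every value the graph assigns to \<open>x\<close> is
    \<open>farey_limit x\<close>, which gives the uniqueness that \<open>THE\<close>
    requires.\<close>
  then show ?thesis
    unfolding question_mark_rat_def
    by (metis question_mark_graph_farey_limit the_equality)
qed

section \<open>Extension to irrational points\<close>

lemma islimpt_Rats_Icc:
  fixes x :: real
  assumes "x \<in> {0..1}"
  shows "x islimpt (\<rat> \<inter> {0..1})"
  unfolding islimpt_approachable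
proof (intro allI impI)
  fix e :: real assume "e > 0"
  \<comment> \<open>At an endpoint only one side of \<open>x\<close> stays in the interval, hence
    the disjunction.\<close>
  have "max 0 (x - e) < x \<or> x < min 1 (x + e)" using assms \<open>e > 0\<close> by auto
  then obtain r where "r \<in> \<rat>" "max 0 (x - e) < r \<and> r < x \<or> x < r \<and> r < min 1 (x + e)"
    using Rats_dense_in_real by metis
  then show "\<exists>r\<in>\<rat> \<inter> {0..1}. r \<noteq> x \<and> dist r x < e"
    using assms by (intro bexI[of _ r]) (auto simp: dist_real_def)
qed

lemma question_mark_eq_farey_limit:
  assumes "x \<in> {0..1}"
  shows "question_mark x = farey_limit x"
proof (cases "x \<in> \<rat>")
  case True
  then show ?thesis using assms by (simp add: question_mark_def question_mark_rat_eq_farey_limit)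
next
  case False
  have "(farey_limit \<longlongrightarrow> farey_limit x) (at x within {0..1})"
    using continuous_on_farey_limit assms by (simp add: continuous_on)
  then have "(farey_limit \<longlongrightarrow> farey_limit x) (at x within \<rat> \<inter> {0..1})"
    by (rule tendsto_within_subset) auto
  then have "(question_mark_rat \<longlongrightarrow> farey_limit x) (at x within \<rat> \<inter> {0..1})"
    by (rule Lim_transform_within[where d = 1]) (auto simp: question_mark_rat_eq_farey_limit)
  \<comment> \<open>Rationals accumulate at \<open>x\<close>, so the filter is nontrivial and
    \<open>Lim\<close> returns this limit.\<close>
  then show ?thesis
    using islimpt_Rats_Icc[OF assms] False
    by (simp add: question_mark_def tendsto_Lim trivial_limit_within)
qed

text \<open>A rational \<open>p/q\<close> of the interval is the left end of the unimodular pairs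
  \<open>p/q, (c + n p)/(d + n q)\<close>, whose right ends tend to \<open>p/q\<close>.\<close>

lemma farey_limit_strict_mono:
  assumes "0 \<le> x" "x < y" "y \<le> 1"
  shows "farey_limit x < farey_limit y"
proof -
  obtain r where r: "r \<in> \<rat>" "x < r" "r < y" using Rats_dense_in_real[OF assms(2)] by blast
  obtain p q :: int where pq: "q > 0" "coprime p q" "r = of_int p / of_int q"
    using Rats_cases'[OF r(1)] by metis
  have p: "0 < p" "p < q"
  proof -
    have "0 < r" "r < 1" using r assms by auto
    then show "0 < p" "p < q" using pq by (auto simp: zero_less_divide_iff divide_less_eq)
  qed
  obtain c d where cd: "0 < d" "d < q" "0 \<le> c" "c \<le> d" "0 \<le> p - c" "p - c \<le> q - d"
    "c * q - p * d = 1"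
    using unimodular_parents[OF pq(2) p] by blast
  \<comment> \<open>The pair \<open>r\<close>, \<open>?s\<close> will have gap
    \<open>1 / (q * (d + n * q))\<close>, at most \<open>1 / n\<close>; this \<open>n\<close> makes
    it smaller than \<open>y - r\<close>.\<close>
  obtain n :: nat where n: "1 / (y - r) < real n" using reals_Archimedean2 by blast
  let ?s = "real_of_int (c + int n * p) / of_int (d + int n * q)"
  have lim: "farey_limit r < farey_limit ?s"
    unfolding pq(3)
    using cd pq p
    by (intro conjunct2[OF farey_limit_unimodular])
       (auto simp: algebra_simps add_pos_nonneg intro!: add_mono mult_right_mono)
  have "?s - r = 1 / (of_int q * of_int (d + int n * q))"
  proof -
    have "(c + int n * p) * q - p * (d + int n * q) = 1"
      using cd(7) by (simp add: algebra_simps)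
    then have "real_of_int (c + int n * p) * of_int q - of_int p * of_int (d + int n * q) = 1"
      by (metis of_int_1 of_int_diff of_int_mult)
    moreover have "0 < d + int n * q" using cd(1) pq(1) by (simp add: add_pos_nonneg)
    ultimately show ?thesis
      using pq(1) unfolding pq(3) by (subst diff_frac_eq) (simp_all del: of_int_add add: mult.commute)
  qed
  also have "\<dots> < y - r"
  proof -
    have n0: "0 < real n" using n r by (smt (verit) divide_pos_pos)
    have "1 < real n * (y - r)" using n r by (simp add: field_simps)
    also have "real n \<le> of_int q * of_int (d + int n * q)"
    proof -
      have "int n * 1 \<le> int n * q" using pq by (intro mult_left_mono) auto
      then have "int n \<le> d + int n * q" using cd by simp
      also have "\<dots> \<le> q * (d + int n * q)"
        using mult_right_mono[of 1 q "d + int n * q"] pq(1) cd(1) by simp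
      finally have "real_of_int (int n) \<le> real_of_int (q * (d + int n * q))"
        by (rule of_int_le_iff[THEN iffD2])
      then show ?thesis by simp
    qed
    finally have "1 < (of_int q * of_int (d + int n * q)) * (y - r)"
      using r by (simp add: mult_right_mono)
    moreover have "0 < real_of_int q * of_int (d + int n * q)"
      using \<open>real n \<le> of_int q * of_int (d + int n * q)\<close> n0 by linarith
    ultimately show ?thesis by (simp add: divide_less_eq mult.commute)
  qed
  finally have s: "?s < y" by simp
  have "0 \<le> ?s"
    using cd(1,3) p by (intro divide_nonneg_nonneg) (simp_all del: of_int_add)
  have "farey_limit x \<le> farey_limit r" using r assms by (intro farey_limit_mono) auto
  also note lim
  also have "farey_limit ?s \<le> farey_limit y"
    using s \<open>0 \<le> ?s\<close> assms by (intro farey_limit_mono) auto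
  finally show ?thesis .
qed

section \<open>Homeomorphism and conjugacy\<close>

lemma homeomorphism_farey_limit: "\<exists>h. homeomorphism {0..1} {0..1} farey_limit h"
proof (rule homeomorphism_compact)
  show "inj_on farey_limit {0..1}"
  proof (rule linorder_inj_onI')
    fix x y :: real assume "x \<in> {0..1}" "y \<in> {0..1}" "x < y"
    then show "farey_limit x \<noteq> farey_limit y" using farey_limit_strict_mono[of x y] by auto
  qed
  show "farey_limit ` {0..1} = {0..1}"
  proof
    show "{0..1} \<subseteq> farey_limit ` {0..1}"
    proof
      fix y :: real assume "y \<in> {0..1}"
      then show "y \<in> farey_limit ` {0..1}"
        using IVT'[of farey_limit 0 y 1] continuous_on_farey_limit by force
    qed
  qed (use farey_limit_mem in blast)
qed (auto simp: continuous_on_farey_limit)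

text \<open>The functional equation is solved for the value at \<open>backward_farey x\<close>.
  Strict monotonicity keeps left-half values below 1/2, where \<open>doubling_map\<close> changes
  branch; weak monotonicity suffices on the right.\<close>

lemma doubling_map_farey_limit:
  assumes "x \<in> {0..1}"
  shows "doubling_map (farey_limit x) = farey_limit (backward_farey x)"
proof (cases "x < 1/2")
  case True
  then have "farey_limit x < 1/2" using farey_limit_strict_mono[of x "1/2"] assms by simp
  then show ?thesis
    using True farey_limit_functional_equation[OF assms] by (simp add: doubling_map_def)
next
  case False
  then have "1/2 \<le> farey_limit x" using farey_limit_mono[of "1/2" x] assms by simp
  then show ?thesis
    using False farey_limit_functional_equation[OF assms] by (simp add: doubling_map_def)
qed

theorem proposition7p3:
  "topologically_conjugated_via {0..1} backward_farey {0..1} doubling_map question_mark \<and>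
   (\<forall>x\<in>{0..1}. (doubling_map \<circ> question_mark) x = (question_mark \<circ> backward_farey) x)"
proof -
  have conj: "\<forall>x\<in>{0..1}. (doubling_map \<circ> question_mark) x = (question_mark \<circ> backward_farey) x"
    by (simp add: question_mark_eq_farey_limit backward_farey_mem doubling_map_farey_limit
        del: atLeastAtMost_iff)
  obtain h where "homeomorphism {0..1} {0..1} farey_limit h"
    using homeomorphism_farey_limit by blast
  then have "homeomorphism {0..1} {0..1} question_mark h"
    by (rule homeomorphism_cong) (auto simp: question_mark_eq_farey_limit)
  then show ?thesis
    using conj backward_farey_mem doubling_map_mem
    by (auto simp: topologically_conjugated_via_def simp del: atLeastAtMost_iff)
qed

end
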